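(* Let $B$ be a real Banach space and let $C$ be a nonempty subset of $B$. Then: (a) $\Pi_C(x)\supseteq\mathcal{J}(x)\cap C$ for every $x\in B$. (b) $\Pi_C(x)=\mathcal{J}(x)\cap C\ni x$ for every $x\in C$.
   Context: $B^*$ is the dual of $B$ and $\langle\cdot,\cdot\rangle$ is the pairing between $B^*$ and $B$. The normalized duality map is $J(x)=\{\psi\in B^*:\langle\psi,x\rangle=\|\psi\|\|x\|=\|x\|^2=\|\psi\|^2\}$ for $x\in B$. The set of generalized identical points of $x\in B$ is $\mathcal{J}(x)=\{y\in B: J(x)\cap J(y)\neq\emptyset\}$. $V(\phi,x)=\|\phi\|^2-2\langle\phi,x\rangle+\|x\|^2$ for $\phi\in B^*$, $x\in B$. The generalized projection is $\pi_C(\phi)=\{u\in C: V(\phi,u)=\inf_{y\in C}V(\phi,y)\}$ for $\phi\in B^*$ (possibly empty), and the generalized metric projection $\Pi_C:B\to 2^C$ is $\Pi_C(x)=\bigcup_{jx\in J(x)}\pi_C(jx)$. *)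

theory Defs
  imports "HOL-Analysis.Analysis"
begin

text \<open>The dual space of a real normed space \<open>'a\<close> is the type \<open>'a \<Rightarrow>\<^sub>L real\<close> of bounded linear
  functionals with the operator norm; the pairing of \<open>\<psi>\<close> and \<open>x\<close> is \<open>blinfun_apply \<psi> x\<close>.\<close>

definition duality_map :: "'a::real_normed_vector \<Rightarrow> ('a \<Rightarrow>\<^sub>L real) set" where
  "duality_map x = {\<psi>. blinfun_apply \<psi> x = norm \<psi> * norm x \<and>
                       norm \<psi> * norm x = (norm x)\<^sup>2 \<and> (norm x)\<^sup>2 = (norm \<psi>)\<^sup>2}"

definition gen_identical :: "'a::real_normed_vector \<Rightarrow> 'a set" where
  "gen_identical x = {y. duality_map x \<inter> duality_map y \<noteq> {}}"

definition lyapunov_V :: "('a::real_normed_vector \<Rightarrow>\<^sub>L real) \<Rightarrow> 'a \<Rightarrow> real" where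
  "lyapunov_V \<phi> x = (norm \<phi>)\<^sup>2 - 2 * blinfun_apply \<phi> x + (norm x)\<^sup>2"

text \<open>The infimum below is taken in \<open>real\<close>. It is the usual one for nonempty \<open>C\<close>, because
  \<open>lyapunov_V \<phi> y \<ge> (norm \<phi> - norm y)\<^sup>2 \<ge> 0\<close>.\<close>

definition gen_proj :: "'a::real_normed_vector set \<Rightarrow> ('a \<Rightarrow>\<^sub>L real) \<Rightarrow> 'a set" where
  "gen_proj C \<phi> = {u \<in> C. lyapunov_V \<phi> u = (INF y\<in>C. lyapunov_V \<phi> y)}"

definition gen_metric_proj :: "'a::real_normed_vector set \<Rightarrow> 'a \<Rightarrow> 'a set" where
  "gen_metric_proj C x = (\<Union>jx\<in>duality_map x. gen_proj C jx)"

end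

theory Submission
  imports Defs
begin

text \<open>Since \<open>(\<parallel>\<phi>\<parallel> - \<parallel>y\<parallel>)\<^sup>2 \<le> V(\<phi>, y)\<close>, the functional \<open>V(\<phi>, \<cdot>)\<close> is nonnegative and vanishes exactly at
  those \<open>y\<close> with \<open>\<phi> \<in> J(y)\<close>. So as soon as some point of \<open>C\<close> is a zero of \<open>V(\<phi>, \<cdot>)\<close>, the set
  \<open>\<pi>\<^sub>C(\<phi>)\<close> consists of all the zeros in \<open>C\<close>. That \<open>x \<in> \<J>(x)\<close> means that \<open>J(x)\<close> is nonempty, which is
  the Hahn-Banach theorem. The latter is obtained by finding a minimal sublinear functional below a given
  one and showing that minimality forces additivity.\<close>

section \<open>Sublinear functionals and the minimal ones among them\<close>

definition sublinear :: "('a::real_vector \<Rightarrow> real) \<Rightarrow> bool" where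
  "sublinear p \<longleftrightarrow> (\<forall>x y. p (x + y) \<le> p x + p y) \<and> (\<forall>c x. 0 < c \<longrightarrow> p (c *\<^sub>R x) = c * p x)"

text \<open>One inequality suffices for homogeneity: used for \<open>inverse c\<close> at
  \<open>c *\<^sub>R x\<close>, it gives the reverse one.\<close>

lemma sublinearI:
  assumes "\<And>x y. p (x + y) \<le> p x + p y" and "\<And>c x. 0 < c \<Longrightarrow> p (c *\<^sub>R x) \<le> c * p x"
  shows "sublinear p"
  unfolding sublinear_def
proof (intro conjI allI impI)
  fix c :: real and x assume c: "0 < c"
  have "p x \<le> inverse c * p (c *\<^sub>R x)"
    using assms(2)[of "inverse c" "c *\<^sub>R x"] c by simp
  then have "c * p x \<le> p (c *\<^sub>R x)"
    using c by (simp add: field_simps)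
  with assms(2)[OF c, of x] show "p (c *\<^sub>R x) = c * p x" by simp
qed (rule assms(1))

lemma sublinear_add: "sublinear p \<Longrightarrow> p (x + y) \<le> p x + p y"
  by (simp add: sublinear_def)

lemma sublinear_zero: "sublinear p \<Longrightarrow> p 0 = 0"
  unfolding sublinear_def by (drule conjunct2, drule spec[of _ 2], drule spec[of _ 0]) simp

lemma sublinear_scaleR: "sublinear p \<Longrightarrow> 0 \<le> c \<Longrightarrow> p (c *\<^sub>R x) = c * p x"
  using sublinear_zero[of p] by (cases "c = 0") (auto simp: sublinear_def)

lemma sublinear_minus_le: "sublinear p \<Longrightarrow> - p (- x) \<le> p x"
  using sublinear_add[of p x "- x"] sublinear_zero[of p] by simp

lemma sublinear_norm: "sublinear (norm :: 'a::real_normed_vector \<Rightarrow> real)"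
  by (rule sublinearI) (auto intro: norm_triangle_ineq)

text \<open>For sublinear \<open>p\<close> this is the largest sublinear functional below
  \<open>p\<close> whose value at \<open>- z\<close> is at most \<open>- p z\<close>; it is linear
  on the line through \<open>z\<close>.\<close>

definition sublinear_along :: "('a::real_vector \<Rightarrow> real) \<Rightarrow> 'a \<Rightarrow> 'a \<Rightarrow> real" where
  "sublinear_along p z y = (INF t\<in>{0..}. p (y + t *\<^sub>R z) - t * p z)"

text \<open>The bound does not depend on \<open>t\<close>, so the real infimum in
  \<open>sublinear_along\<close> is a genuine one.\<close>

lemma sublinear_along_lower:
  assumes "sublinear p" "0 \<le> t"
  shows "- p (- y) \<le> p (y + t *\<^sub>R z) - t * p z"
  using sublinear_add[OF assms(1), of "y + t *\<^sub>R z" "- y"] sublinear_scaleR[OF assms, of z] by simp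

lemma sublinear_along_le:
  assumes "sublinear p" "0 \<le> t"
  shows "sublinear_along p z y \<le> p (y + t *\<^sub>R z) - t * p z"
proof -
  have "bdd_below ((\<lambda>t. p (y + t *\<^sub>R z) - t * p z) ` {0..})"
    by (rule bdd_belowI2[where m = "- p (- y)"], rule sublinear_along_lower[OF assms(1)]) simp
  then show ?thesis
    unfolding sublinear_along_def by (rule cINF_lower) (simp add: assms(2))
qed

lemma sublinear_along_greatest:
  "(\<And>t. 0 \<le> t \<Longrightarrow> m \<le> p (y + t *\<^sub>R z) - t * p z) \<Longrightarrow> m \<le> sublinear_along p z y"
  unfolding sublinear_along_def by (intro cINF_greatest) auto

lemma sublinear_along_le_self: "sublinear p \<Longrightarrow> sublinear_along p z \<le> p"
  using sublinear_along_le[of p 0 z] by (auto simp: le_fun_def)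

lemma sublinear_sublinear_along:
  assumes p: "sublinear p"
  shows "sublinear (sublinear_along p z)"
proof (rule sublinearI)
  let ?q = "sublinear_along p z"
  fix x y
  \<comment> \<open>The parameter \<open>s + t\<close> is admissible for \<open>x + y\<close>; the
    infima over \<open>s\<close> and then over \<open>t\<close> are taken one after the
    other.\<close>
  have *: "?q (x + y) \<le> (p (x + s *\<^sub>R z) - s * p z) + (p (y + t *\<^sub>R z) - t * p z)"
    if "0 \<le> s" "0 \<le> t" for s t
    using sublinear_along_le[OF p, of "s + t" z "x + y"] that
      sublinear_add[OF p, of "x + s *\<^sub>R z" "y + t *\<^sub>R z"]
    by (simp add: algebra_simps)
  have "?q (x + y) - (p (y + t *\<^sub>R z) - t * p z) \<le> ?q x" if "0 \<le> t" for t
    using *[OF _ that] by (intro sublinear_along_greatest) (simp add: diff_le_eq)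
  then have "?q (x + y) - ?q x \<le> ?q y"
    by (intro sublinear_along_greatest) (smt (verit))
  then show "?q (x + y) \<le> ?q x + ?q y" by simp
next
  let ?q = "sublinear_along p z"
  fix c :: real and x assume c: "0 < c"
  have "?q (c *\<^sub>R x) / c \<le> ?q x"
  proof (rule sublinear_along_greatest)
    fix t :: real assume t: "0 \<le> t"
    have "?q (c *\<^sub>R x) \<le> p (c *\<^sub>R x + (c * t) *\<^sub>R z) - (c * t) * p z"
      using c t by (intro sublinear_along_le[OF p]) simp
    also have "\<dots> = c * (p (x + t *\<^sub>R z) - t * p z)"
      using sublinear_scaleR[OF p, of c "x + t *\<^sub>R z"] c by (simp add: algebra_simps)
    finally show "?q (c *\<^sub>R x) / c \<le> p (x + t *\<^sub>R z) - t * p z"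
      using c by (simp add: field_simps)
  qed
  then show "?q (c *\<^sub>R x) \<le> c * ?q x"
    using c by (simp add: field_simps)
qed

text \<open>By minimality \<open>q\<close> equals its own modification along every \<open>z\<close>,
  and the parameter 1 in that infimum yields superadditivity.\<close>

lemma linear_minimal_sublinear:
  assumes q: "sublinear q" and min: "\<And>r. sublinear r \<Longrightarrow> r \<le> q \<Longrightarrow> r = q"
  shows "linear q"
proof -
  have "sublinear_along q z = q" for z
    by (intro min sublinear_sublinear_along sublinear_along_le_self q)
  then have "q y + q z \<le> q (y + z)" for y z
    using sublinear_along_le[OF q, of 1 z y] by simp
  with sublinear_add[OF q] have add: "q (y + z) = q y + q z" for y z
    by (simp add: order_antisym)
  have neg: "q (- y) = - q y" for y
    using add[of y "- y"] sublinear_zero[OF q] by simp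
  show ?thesis
  proof (rule linearI)
    fix c :: real and x
    show "q (c *\<^sub>R x) = c *\<^sub>R q x"
    proof (cases "0 \<le> c")
      case True
      then show ?thesis by (simp add: sublinear_scaleR[OF q])
    next
      case False
      then show ?thesis
        using sublinear_scaleR[OF q, of "- c" x] neg[of "c *\<^sub>R x"] by simp
    qed
  qed (rule add)
qed

lemma sublinear_INF_chain:
  assumes D: "D \<noteq> {}" and sub: "\<And>q. q \<in> D \<Longrightarrow> sublinear q \<and> q \<le> p"
    and chain: "\<And>q r. q \<in> D \<Longrightarrow> r \<in> D \<Longrightarrow> q \<le> r \<or> r \<le> q"
  shows "sublinear (\<lambda>y. INF q\<in>D. q y)" (is "sublinear ?m")
    and "\<And>q. q \<in> D \<Longrightarrow> (\<lambda>y. INF q\<in>D. q y) \<le> q"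
proof -
  have "- p (- y) \<le> q y" if "q \<in> D" for q y
    using sublinear_minus_le[of q y] sub[OF that] le_funD[of q p "- y"] by simp
  then have bdd: "bdd_below ((\<lambda>q. q y) ` D)" for y
    by (rule bdd_belowI2)
  have lower: "?m y \<le> q y" if "q \<in> D" for q y
    using that by (intro cINF_lower bdd)
  then show "\<And>q. q \<in> D \<Longrightarrow> ?m \<le> q" by (simp add: le_fun_def)
  show "sublinear ?m"
  proof (rule sublinearI)
    fix x y
    have *: "?m (x + y) \<le> q x + r y" if qr: "q \<in> D" "r \<in> D" for q r
    proof -
      \<comment> \<open>In a chain the smaller of \<open>q\<close> and \<open>r\<close> lies below
        both, so its subadditivity serves for the pair.\<close>
      obtain s where s: "s \<in> D" "s \<le> q" "s \<le> r"
        using chain[OF qr] qr by blast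
      have "?m (x + y) \<le> s (x + y)" by (rule lower[OF s(1)])
      also have "\<dots> \<le> s x + s y" using sub[OF s(1)] by (simp add: sublinear_add)
      also have "\<dots> \<le> q x + r y" using s by (intro add_mono) (auto simp: le_fun_def)
      finally show ?thesis .
    qed
    have "?m (x + y) - r y \<le> ?m x" if "r \<in> D" for r
      using *[OF _ that] by (intro cINF_greatest D) (simp add: diff_le_eq)
    then have "?m (x + y) - ?m x \<le> ?m y"
      by (intro cINF_greatest D) (smt (verit))
    then show "?m (x + y) \<le> ?m x + ?m y" by simp
  next
    fix c :: real and x assume c: "0 < c"
    have "?m (c *\<^sub>R x) / c \<le> ?m x"
    proof (intro cINF_greatest D)
      fix q assume q: "q \<in> D"
      have "?m (c *\<^sub>R x) \<le> c * q x"
        using lower[OF q, of "c *\<^sub>R x"] sublinear_scaleR[of q c x] sub[OF q] c by simp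
      then show "?m (c *\<^sub>R x) / c \<le> q x" using c by (simp add: field_simps)
    qed
    then show "?m (c *\<^sub>R x) \<le> c * ?m x" using c by (simp add: field_simps)
  qed
qed

section \<open>The Hahn-Banach theorem and norming functionals\<close>

theorem hahn_banach_sublinear:
  assumes p: "sublinear p"
  obtains f where "linear f" "f \<le> p"
proof -
  define S where "S = {q. sublinear q \<and> q \<le> p}"
  have "\<exists>m\<in>S. \<forall>a\<in>S. a \<le> m \<longrightarrow> a = m"
  proof (rule predicate_Zorn)
    \<comment> \<open>The order is reversed, so that the maximal element from Zorn's lemma is a
      minimal sublinear functional.\<close>
    show "partial_order_on S (relation_of (\<lambda>q r. r \<le> q) S)"
      by (rule partial_order_on_relation_ofI) auto
    fix D assume D: "D \<in> Chains (relation_of (\<lambda>q r. r \<le> q) S)"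
    then have DS: "D \<subseteq> S" and chain: "\<And>q r. q \<in> D \<Longrightarrow> r \<in> D \<Longrightarrow> q \<le> r \<or> r \<le> q"
      by (auto simp: Chains_def relation_of_def)
    show "\<exists>u\<in>S. \<forall>a\<in>D. u \<le> a"
    proof (cases "D = {}")
      case True
      then show ?thesis using p by (auto simp: S_def)
    next
      case False
      have sub: "\<And>q. q \<in> D \<Longrightarrow> sublinear q \<and> q \<le> p" using DS by (auto simp: S_def)
      note m = sublinear_INF_chain[OF False sub chain]
      have "(\<lambda>y. INF q\<in>D. q y) \<le> p"
        using False m(2) sub by (metis ex_in_conv order_trans)
      with m show ?thesis by (auto simp: S_def)
    qed
  qed
  then obtain q where q: "sublinear q" "q \<le> p"
    and min: "\<And>r. sublinear r \<Longrightarrow> r \<le> p \<Longrightarrow> r \<le> q \<Longrightarrow> r = q"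
    by (auto simp: S_def)
  have "linear q"
    using q min by (intro linear_minimal_sublinear) (auto intro: order_trans)
  then show ?thesis using q(2) that by blast
qed

text \<open>Domination by \<open>sublinear_along norm x\<close> instead of \<open>norm\<close> also
  forces \<open>f (- x) \<le> - norm x\<close>, which fixes the value at \<open>x\<close>.\<close>

lemma norming_functional:
  fixes x :: "'a::real_normed_vector"
  obtains f :: "'a \<Rightarrow>\<^sub>L real" where "norm f \<le> 1" "blinfun_apply f x = norm x"
proof -
  let ?p = "sublinear_along norm x"
  obtain f where f: "linear f" "f \<le> ?p"
    using hahn_banach_sublinear[OF sublinear_sublinear_along[OF sublinear_norm]] .
  have le: "f y \<le> norm y" for y
    by (rule le_funD[OF order_trans[OF f(2) sublinear_along_le_self[OF sublinear_norm]]])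
  have abs: "\<bar>f y\<bar> \<le> norm y" for y
    using le[of y] le[of "- y"] linear_neg[OF f(1), of y] by simp
  have "f (- x) \<le> ?p (- x)" using f(2) by (simp add: le_fun_def)
  also have "\<dots> \<le> - norm x"
    using sublinear_along_le[OF sublinear_norm, of 1 x "- x"] by simp
  finally have x: "f x = norm x"
    using le[of x] linear_neg[OF f(1), of x] by simp
  have "bounded_linear f"
    using f(1) abs by (intro bounded_linear_intro[where K = 1]) (auto simp: linear_add linear_cmul)
  then have app: "blinfun_apply (Blinfun f) = f" by (rule bounded_linear_Blinfun_apply)
  show ?thesis
  proof (rule that[of "Blinfun f"])
    show "norm (Blinfun f) \<le> 1" by (rule norm_blinfun_bound) (simp_all add: app abs)
  qed (simp add: app x)
qed

section \<open>The duality map and the zeros of \<open>lyapunov_V\<close>\<close>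

lemma duality_map_iff: "\<psi> \<in> duality_map x \<longleftrightarrow> norm \<psi> = norm x \<and> blinfun_apply \<psi> x = (norm x)\<^sup>2"
proof -
  have "(norm x)\<^sup>2 = (norm \<psi>)\<^sup>2 \<longleftrightarrow> norm \<psi> = norm x"
    using power2_eq_iff_nonneg[of "norm x" "norm \<psi>"] by auto
  then show ?thesis
    unfolding duality_map_def mem_Collect_eq by (metis power2_eq_square)
qed

lemma duality_map_nonempty: "duality_map x \<noteq> {}"
proof -
  obtain f :: "'a \<Rightarrow>\<^sub>L real" where f: "norm f \<le> 1" "blinfun_apply f x = norm x"
    by (rule norming_functional)
  let ?g = "norm x *\<^sub>R f"
  have gx: "blinfun_apply ?g x = (norm x)\<^sup>2"
    using f(2) by (simp add: scaleR_blinfun.rep_eq power2_eq_square)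
  have "norm ?g = norm x"
  \<comment> \<open>For nonzero \<open>x\<close> the norming functional has norm exactly 1; for
    \<open>x = 0\<close> both sides vanish.\<close>
  proof (cases "x = 0")
    case False
    have "norm x \<le> norm f * norm x"
      using norm_blinfun[of f x] f(2) by simp
    then show ?thesis using False f(1) by simp
  qed simp
  with gx have "?g \<in> duality_map x" by (simp add: duality_map_iff)
  then show ?thesis by blast
qed

lemma self_gen_identical: "x \<in> gen_identical x"
  using duality_map_nonempty[of x] by (simp add: gen_identical_def)

lemma square_norm_diff_le_lyapunov_V: "(norm \<phi> - norm y)\<^sup>2 \<le> lyapunov_V \<phi> y"
  using norm_blinfun[of \<phi> y] by (simp add: lyapunov_V_def power2_diff)

lemma lyapunov_V_nonneg: "0 \<le> lyapunov_V \<phi> y"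
  by (rule order_trans[OF zero_le_power2 square_norm_diff_le_lyapunov_V])

lemma lyapunov_V_eq_0_iff: "lyapunov_V \<phi> y = 0 \<longleftrightarrow> \<phi> \<in> duality_map y"
proof
  assume V: "lyapunov_V \<phi> y = 0"
  then have "norm \<phi> = norm y"
    using square_norm_diff_le_lyapunov_V[of \<phi> y] by simp
  \<comment> \<open>With equal norms, \<open>lyapunov_V \<phi> y\<close> is twice the difference of
    \<open>(norm y)\<^sup>2\<close> and the pairing.\<close>
  with V show "\<phi> \<in> duality_map y" by (simp add: lyapunov_V_def duality_map_iff)
qed (simp add: lyapunov_V_def duality_map_iff)

text \<open>The point \<open>x\<close> attains the lower bound 0, so the infimum is 0 and the
  minimizers are the zeros in \<open>C\<close>.\<close>

lemma gen_proj_eq_zeros: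
  assumes "x \<in> C" "\<phi> \<in> duality_map x"
  shows "gen_proj C \<phi> = {u \<in> C. \<phi> \<in> duality_map u}"
proof -
  have "(INF y\<in>C. lyapunov_V \<phi> y) = 0"
    using assms lyapunov_V_nonneg[of \<phi>]
    by (intro cInf_eq_minimum) (auto simp: image_iff lyapunov_V_eq_0_iff[symmetric])
  then show ?thesis by (simp add: gen_proj_def lyapunov_V_eq_0_iff)
qed

theorem theorem4p6:
  fixes C :: "'a::banach set"
  assumes "C \<noteq> {}"
  shows "(\<forall>x. gen_identical x \<inter> C \<subseteq> gen_metric_proj C x) \<and>
         (\<forall>x\<in>C. gen_metric_proj C x = gen_identical x \<inter> C \<and> x \<in> gen_identical x \<inter> C)"
proof (intro conjI allI ballI)
  \<comment> \<open>Here \<open>x\<close> may lie outside \<open>C\<close>; the zero in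
    \<open>C\<close> is the generalized identical point itself, through a functional shared with
    \<open>x\<close>.\<close>
  show sub: "gen_identical x \<inter> C \<subseteq> gen_metric_proj C x" for x
    by (auto simp: gen_identical_def gen_metric_proj_def gen_proj_eq_zeros)
  fix x assume x: "x \<in> C"
  \<comment> \<open>Now \<open>x\<close> itself is a zero in \<open>C\<close> for every functional
    in \<open>duality_map x\<close>.\<close>
  have "gen_metric_proj C x \<subseteq> gen_identical x \<inter> C"
    using gen_proj_eq_zeros[OF x] by (auto simp: gen_identical_def gen_metric_proj_def)
  with sub show "gen_metric_proj C x = gen_identical x \<inter> C" by (simp add: subset_antisym)
  show "x \<in> gen_identical x \<inter> C" using x self_gen_identical by blast
qed

end
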